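(* For any triangle-free graph $G$ on $n$ vertices, we have $$\frac{\lambda_1+\lambda_n}{n}\leq \frac{1-14^{-1/3}}{1+14^{1/3}}.$$
   Context: All graphs are finite and simple. For a graph $G$ on $n\ge 1$ vertices, $\lambda_1\geq\dots\geq\lambda_n$ denote the eigenvalues (with multiplicity) of its adjacency matrix $A(G)$. *)

theory Defs
  imports
    "Graph_Theory.Pair_Digraph"
    "Jordan_Normal_Form.Char_Poly"
    Complex_Main
begin

text \<open>
  A finite simple graph is a \<open>pair_graph\<close>: a finite vertex set together with a symmetric,
  irreflexive set of ordered pairs of vertices, so an edge is represented by both of its
  orientations.
\<close>

text \<open>Vertices of a triangle are automatically distinct, as there are no loops.\<close>

definition triangle_free :: "'a pair_pre_digraph \<Rightarrow> bool" where
  "triangle_free G \<longleftrightarrow>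
     \<not> (\<exists>u v w. (u, v) \<in> parcs G \<and> (v, w) \<in> parcs G \<and> (w, u) \<in> parcs G)"

text \<open>The adjacency matrix relative to an enumeration \<open>vs\<close> of the vertices.\<close>

definition adj_matrix :: "'a pair_pre_digraph \<Rightarrow> 'a list \<Rightarrow> real mat" where
  "adj_matrix G vs =
     mat (length vs) (length vs) (\<lambda>(i, j). if (vs ! i, vs ! j) \<in> parcs G then 1 else 0)"

text \<open>
  The real eigenvalues of \<open>A\<close>, counted with (algebraic) multiplicity, in nonincreasing order,
  indexed from 1. For a real symmetric \<open>n \<times> n\<close> matrix all roots of the characteristic
  polynomial are real, so that \<open>mat_eigenvalue A k\<close> is meaningful exactly for \<open>1 \<le> k \<le> n\<close>.
\<close>

definition mat_eigenvalue :: "real mat \<Rightarrow> nat \<Rightarrow> real" where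
  "mat_eigenvalue A k = rev (sorted_list_of_multiset (proots (char_poly A))) ! (k - 1)"

end

theory Submission
  imports Defs "Jordan_Normal_Form.Schur_Decomposition" "HOL-Analysis.Convex"
begin

text \<open>
  Let \<open>a\<close> be the largest eigenvalue and \<open>- b\<close> the smallest. If \<open>a \<le> b\<close> the claim is trivial, so let
  \<open>x = a / b > 1\<close>. Two moments of the spectrum are used. A triangle-free graph has no closed walks
  of length three, so the cubes of the eigenvalues sum to \<open>0\<close>. The squares sum to the number of arcs,
  which is the sum of all entries of the adjacency matrix. By the Rayleigh bound for the all-ones
  vector (\<open>entry_sum_le_spectral_radius\<close>), this sum is at most \<open>n * a\<close>.

  Divide the absolute values of the negative eigenvalues by \<open>b\<close>. The resulting numbers \<open>v\<close> lie
  between \<open>0\<close> and \<open>1\<close>, their cubes sum to some \<open>s \<ge> x ^ 3\<close>, and their squares sum to some \<open>q\<close> with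
  \<open>x\<^sup>2 + q \<le> n / b * x\<close>. Hence \<open>(a - b) / n = (x - 1) * b / n\<close> is at most \<open>x * (x - 1) / (x\<^sup>2 + q)\<close>.
  Since \<open>v\<^sup>2 \<ge> v ^ 3\<close>, also \<open>q \<ge> s \<ge> x ^ 3\<close>, which gives the bound \<open>(x - 1) / (x * (x + 1))\<close>. Its maximum
  \<open>3 - 2 * sqrt 2\<close> is attained at \<open>x = 1 + sqrt 2\<close>, where \<open>x ^ 3 = 7 + 5 * sqrt 2\<close> is about \<open>14.07\<close>.

  This maximum cannot be reached, because \<open>q = s = x ^ 3\<close> would force every \<open>v\<close> to be \<open>0\<close> or \<open>1\<close>, and so
  \<open>x ^ 3\<close> to be an integer. The lemma \<open>sum_squares_gap\<close> makes this quantitative: \<open>q - s\<close> is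
  at least a quarter of the distance from \<open>s\<close> to some integer. The penalty is strong enough to move the optimum to the
  nearby point where \<open>x ^ 3 = 14\<close>, and \<open>(x - 1) / (x * (x + 1))\<close> takes there the value in the theorem
  (\<open>ratio_bound\<close>).
\<close>

section \<open>Spectra of real symmetric matrices\<close>

text \<open>
  For an eigenvector \<open>v\<close> the Hermitian form \<open>q\<close> of \<open>A\<close> at \<open>v\<close> equals its own conjugate, and it is
  also \<open>k\<close> times the squared norm of \<open>v\<close>.
\<close>

lemma symmetric_eigenvalue_real:
  fixes A :: "real mat" and k :: complex
  assumes A: "A \<in> carrier_mat n n" and sym: "transpose_mat A = A"
    and root: "poly (char_poly (map_mat of_real A)) k = 0"
  shows "k \<in> \<real>"
proof -
  let ?A = "map_mat of_real A :: complex mat"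
  have CA: "?A \<in> carrier_mat n n" using A by simp
  obtain v where v: "v \<in> carrier_vec n" "v \<noteq> 0\<^sub>v n" and ev: "?A *\<^sub>v v = k \<cdot>\<^sub>v v"
    using root eigenvalue_root_char_poly[OF CA] CA
    unfolding eigenvalue_def eigenvector_def by auto
  have Asym: "A $$ (j, i) = A $$ (i, j)" if "i < n" "j < n" for i j
    using index_transpose_mat(1)[of i A j] sym A that by auto
  have row: "(\<Sum>j<n. of_real (A $$ (i, j)) * v $ j) = k * v $ i" if "i < n" for i
  proof -
    have "(?A *\<^sub>v v) $ i = (k \<cdot>\<^sub>v v) $ i" using ev by simp
    then show ?thesis using that v A by (simp add: scalar_prod_def lessThan_atLeast0)
  qed
  define q where "q = (\<Sum>i<n. \<Sum>j<n. cnj (v $ i) * of_real (A $$ (i, j)) * v $ j)"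
  define s where "s = (\<Sum>i<n. (cmod (v $ i))\<^sup>2)"
  have "q = (\<Sum>i<n. cnj (v $ i) * (\<Sum>j<n. of_real (A $$ (i, j)) * v $ j))"
    by (simp add: q_def sum_distrib_left mult.assoc)
  also have "\<dots> = (\<Sum>i<n. cnj (v $ i) * (k * v $ i))"
    by (intro sum.cong refl) (simp add: row)
  also have "\<dots> = k * of_real s"
    unfolding s_def of_real_sum sum_distrib_left
    by (intro sum.cong refl) (simp add: complex_norm_square mult_ac del: of_real_power)
  finally have qk: "q = k * of_real s" .
  have "cnj q = (\<Sum>i<n. \<Sum>j<n. v $ i * of_real (A $$ (i, j)) * cnj (v $ j))"
    by (simp add: q_def)
  also have "\<dots> = (\<Sum>j<n. \<Sum>i<n. v $ i * of_real (A $$ (i, j)) * cnj (v $ j))"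
    by (rule sum.swap)
  also have "\<dots> = q"
    unfolding q_def by (intro sum.cong refl) (simp add: Asym mult_ac)
  finally have "cnj q = q" .
  moreover have "s \<noteq> 0"
  proof
    assume "s = 0"
    then have "\<forall>i<n. v $ i = 0" unfolding s_def by (subst (asm) sum_nonneg_eq_0_iff) auto
    then have "v = 0\<^sub>v n" using v by (intro eq_vecI) auto
    with v show False by simp
  qed
  ultimately have "cnj k = k" unfolding qk by simp
  then show ?thesis by (simp add: Reals_cnj_iff)
qed

lemma symmetric_char_poly_splits:
  fixes A :: "real mat"
  assumes A: "A \<in> carrier_mat n n" and sym: "transpose_mat A = A"
  obtains es where "char_poly A = (\<Prod>e\<leftarrow>es. [:- e, 1:])" "length es = n"
proof -
  let ?A = "map_mat of_real A :: complex mat"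
  have CA: "?A \<in> carrier_mat n n" using A by simp
  obtain zs where zs: "char_poly ?A = (\<Prod>z\<leftarrow>zs. [:- z, 1:])" "length zs = n"
    using char_poly_factorized[OF CA] by blast
  have "z \<in> \<real>" if "z \<in> set zs" for z
  proof (rule symmetric_eigenvalue_real[OF A sym])
    show "poly (char_poly ?A) z = 0"
      using that unfolding zs by (auto simp: poly_prod_list prod_list_zero_iff)
  qed
  then have real: "map (of_real \<circ> Re) zs = zs" by (intro map_idI) auto
  define es where "es = map Re zs"
  have zs_es: "zs = map of_real es" unfolding es_def using real by simp
  interpret map_poly_hom: map_poly_inj_idom_hom "of_real :: real \<Rightarrow> complex" ..
  have "map_poly (of_real :: real \<Rightarrow> complex) (char_poly A) = (\<Prod>z\<leftarrow>zs. [:- z, 1:])"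
    using zs(1) of_real_hom.char_poly_hom[OF A, where ?'a = complex] by simp
  also have "\<dots> = map_poly of_real (\<Prod>e\<leftarrow>es. [:- e, 1:])"
    by (simp add: zs_es map_poly_hom.hom_prod_list o_def)
  finally have "char_poly A = (\<Prod>e\<leftarrow>es. [:- e, 1:])" by (rule map_poly_hom.injectivity)
  moreover have "length es = n" using zs(2) by (simp add: es_def)
  ultimately show ?thesis by (rule that)
qed

lemma trace_mult_comm:
  fixes A B :: "'b :: comm_semiring_0 mat"
  assumes "A \<in> carrier_mat n n" "B \<in> carrier_mat n n"
  shows "(\<Sum>i<n. (A * B) $$ (i, i)) = (\<Sum>i<n. (B * A) $$ (i, i))"
proof -
  have "(\<Sum>i<n. (A * B) $$ (i, i)) = (\<Sum>i<n. \<Sum>j<n. A $$ (i, j) * B $$ (j, i))"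
    using assms by (intro sum.cong refl) (simp add: scalar_prod_def lessThan_atLeast0)
  also have "\<dots> = (\<Sum>j<n. \<Sum>i<n. A $$ (i, j) * B $$ (j, i))" by (rule sum.swap)
  also have "\<dots> = (\<Sum>j<n. (B * A) $$ (j, j))"
    using assms by (intro sum.cong refl) (simp add: scalar_prod_def lessThan_atLeast0 mult.commute)
  finally show ?thesis .
qed

lemma upper_triangular_pow:
  fixes B :: "'b :: comm_semiring_1 mat"
  assumes B: "B \<in> carrier_mat n n" and ut: "upper_triangular B"
  shows "upper_triangular (B ^\<^sub>m m)"
    and "i < n \<Longrightarrow> (B ^\<^sub>m m) $$ (i, i) = B $$ (i, i) ^ m"
proof (induction m arbitrary: i)
  case 0
  { case 1 then show ?case using B by auto }
  { case 2 then show ?case using B by auto }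
next
  case (Suc m)
  have Bm: "B ^\<^sub>m m \<in> carrier_mat n n" using B by simp
  have entry: "(B ^\<^sub>m Suc m) $$ (i, j) = (\<Sum>l<n. (B ^\<^sub>m m) $$ (i, l) * B $$ (l, j))"
    if "i < n" "j < n" for i j
    using that B Bm by (simp add: scalar_prod_def lessThan_atLeast0)
  have low: "B $$ (i, j) = 0" "(B ^\<^sub>m m) $$ (i, j) = 0" if "j < i" "i < n" for i j
    using that ut Suc.IH(1) B Bm by (auto simp: upper_triangular_def)
  { case 1
    show ?case
    proof (rule upper_triangularI)
      fix i j assume ij: "j < i" "i < dim_row (B ^\<^sub>m Suc m)"
      then have "i < n" using B by simp
      moreover have "(B ^\<^sub>m m) $$ (i, l) * B $$ (l, j) = 0" if "l < n" for l
        using low(1)[of j l] low(2)[of l i] ij \<open>i < n\<close> that by (cases "l < i") auto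
      ultimately show "(B ^\<^sub>m Suc m) $$ (i, j) = 0" using entry[of i j] ij by simp
    qed }
  { case 2
    have "(B ^\<^sub>m m) $$ (i, l) * B $$ (l, i) = (if l = i then B $$ (i, i) ^ Suc m else 0)"
      if "l < n" for l
      using low(1)[of i l] low(2)[of l i] Suc.IH(2)[OF 2] 2 that
      by (cases l i rule: linorder_cases) (auto simp: mult.commute)
    then show ?case using entry[OF 2 2] 2 by simp }
qed

text \<open>
  The Schur triangular form of \<open>A\<close> carries the eigenvalues on its diagonal, and diagonals of powers
  of triangular matrices are taken entrywise.
\<close>

lemma trace_pow_eq_power_sum:
  fixes A :: "real mat"
  assumes A: "A \<in> carrier_mat n n" and cp: "char_poly A = (\<Prod>e\<leftarrow>es. [:- e, 1:])"
  shows "(\<Sum>i<n. (A ^\<^sub>m m) $$ (i, i)) = (\<Sum>e\<leftarrow>es. e ^ m)"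
proof -
  obtain B P Q where dec: "schur_decomposition A es = (B, P, Q)"
    by (cases "schur_decomposition A es") auto
  have sim: "similar_mat_wit A B P Q" and ut: "upper_triangular B" and diag: "diag_mat B = es"
    using schur_decomposition[OF A cp dec] by auto
  note w = similar_mat_witD2[OF A sim]
  have Bm: "B ^\<^sub>m m \<in> carrier_mat n n" using w by simp
  have "(\<Sum>i<n. (A ^\<^sub>m m) $$ (i, i)) = (\<Sum>i<n. (P * (B ^\<^sub>m m * Q)) $$ (i, i))"
    using similar_mat_wit_pow_id[OF sim, of m] w Bm by (simp add: assoc_mult_mat)
  also have "\<dots> = (\<Sum>i<n. (B ^\<^sub>m m * Q * P) $$ (i, i))"
    using w Bm by (intro trace_mult_comm) auto
  also have "B ^\<^sub>m m * Q * P = B ^\<^sub>m m"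
    using w Bm by (simp add: assoc_mult_mat[OF Bm w(7) w(6)])
  also have "(\<Sum>i<n. (B ^\<^sub>m m) $$ (i, i)) = (\<Sum>i<n. B $$ (i, i) ^ m)"
    using upper_triangular_pow(2)[OF w(5) ut] by simp
  also have "\<dots> = (\<Sum>e\<leftarrow>es. e ^ m)"
    using w unfolding diag[symmetric] diag_mat_def
    by (simp add: sum_list_distinct_conv_sum_set o_def lessThan_atLeast0)
  finally show ?thesis .
qed

lemma symmetric_pow:
  fixes A :: "'b :: comm_semiring_1 mat"
  assumes A: "A \<in> carrier_mat n n" and sym: "transpose_mat A = A"
  shows "transpose_mat (A ^\<^sub>m m) = A ^\<^sub>m m"
proof (induction m)
  case 0
  then show ?case using A by simp
next
  case (Suc m)
  have Am: "A ^\<^sub>m m \<in> carrier_mat n n" using A by simp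
  have "transpose_mat (A ^\<^sub>m Suc m) = A * A ^\<^sub>m m"
    using transpose_mult[OF Am A] Suc sym by simp
  also have "\<dots> = A ^\<^sub>m m * A"
  proof -
    have "A * A ^\<^sub>m k = A ^\<^sub>m k * A" for k
    proof (induction k)
      case 0 then show ?case using A by simp
    next
      case (Suc k)
      have Ak: "A ^\<^sub>m k \<in> carrier_mat n n" using A by simp
      show ?case using Suc assoc_mult_mat[OF A Ak A] assoc_mult_mat[OF Ak A A] by simp
    qed
    then show ?thesis .
  qed
  finally show ?case by simp
qed

lemma pow_mat_add:
  fixes A :: "'b :: comm_semiring_1 mat"
  assumes A: "A \<in> carrier_mat n n"
  shows "A ^\<^sub>m (k + m) = A ^\<^sub>m k * A ^\<^sub>m m"
proof (induction m)
  case 0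
  then show ?case using A by simp
next
  case (Suc m)
  have "A ^\<^sub>m k \<in> carrier_mat n n" "A ^\<^sub>m m \<in> carrier_mat n n" using A by simp_all
  then show ?case using Suc A by (simp add: assoc_mult_mat[of _ n n _ n _ n])
qed

text \<open>
  Both bounds are the Cauchy--Schwarz inequality. With \<open>u\<close> the all-ones vector, the first compares
  \<open>u \<bullet> B u\<close> with the norm of \<open>B u\<close>, whose square is \<open>u \<bullet> (B * B) u\<close>; the second compares \<open>u \<bullet> B u\<close> with
  the Frobenius norm of \<open>B\<close>, whose square is the trace of \<open>B * B\<close>.
\<close>

lemma entry_sum_sq_le:
  fixes B :: "real mat"
  assumes B: "B \<in> carrier_mat n n" and sym: "transpose_mat B = B"
  defines "S \<equiv> \<lambda>M :: real mat. \<Sum>i<n. \<Sum>j<n. M $$ (i, j)"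
  shows "(S B)\<^sup>2 \<le> real n * S (B * B)"
    and "(S B)\<^sup>2 \<le> (real n)\<^sup>2 * (\<Sum>i<n. (B * B) $$ (i, i))"
proof -
  have Bsym: "B $$ (j, i) = B $$ (i, j)" if "i < n" "j < n" for i j
    using index_transpose_mat(1)[of i B j] sym B that by auto
  have sq: "(B * B) $$ (i, j) = (\<Sum>l<n. B $$ (l, i) * B $$ (l, j))" if "i < n" "j < n" for i j
    using that B by (simp add: scalar_prod_def lessThan_atLeast0 Bsym)
  have rows: "(S B)\<^sup>2 \<le> real n * (\<Sum>i<n. (\<Sum>j<n. B $$ (i, j))\<^sup>2)"
    unfolding S_def using sum_squared_le_sum_of_squares[of "\<lambda>i. \<Sum>j<n. B $$ (i, j)" "{..<n}"]
    by (simp add: mult.commute)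
  note rows
  also have "(\<Sum>i<n. (\<Sum>j<n. B $$ (i, j))\<^sup>2)
      = (\<Sum>l<n. \<Sum>i<n. \<Sum>j<n. B $$ (l, i) * B $$ (l, j))"
    by (simp add: power2_eq_square sum_product)
  also have "\<dots> = (\<Sum>i<n. \<Sum>l<n. \<Sum>j<n. B $$ (l, i) * B $$ (l, j))"
    by (rule sum.swap)
  also have "\<dots> = (\<Sum>i<n. \<Sum>j<n. \<Sum>l<n. B $$ (l, i) * B $$ (l, j))"
    by (intro sum.cong refl sum.swap)
  also have "\<dots> = S (B * B)" unfolding S_def by (simp add: sq)
  finally show "(S B)\<^sup>2 \<le> real n * S (B * B)" .
  note rows
  also have "real n * (\<Sum>i<n. (\<Sum>j<n. B $$ (i, j))\<^sup>2)
      \<le> real n * (\<Sum>i<n. real n * (\<Sum>j<n. (B $$ (i, j))\<^sup>2))"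
    using sum_squared_le_sum_of_squares[of "\<lambda>j. B $$ (i, j)" "{..<n}" for i]
    by (intro mult_left_mono sum_mono) (simp_all add: mult.commute)
  also have "\<dots> = (real n)\<^sup>2 * (\<Sum>i<n. (B * B) $$ (i, i))"
    by (simp add: sq Bsym power2_eq_square sum_distrib_left mult.assoc)
  finally show "(S B)\<^sup>2 \<le> (real n)\<^sup>2 * (\<Sum>i<n. (B * B) $$ (i, i))" .
qed

text \<open>
  This is the Rayleigh bound for the all-ones vector, obtained from traces of powers instead of an
  orthogonal eigenbasis. If the average row sum \<open>r\<close> exceeded \<open>a\<close>, then repeated squaring would make
  the entry sum of \<open>A ^ 2 ^ j\<close> at least \<open>n * r ^ 2 ^ j\<close>, whereas the trace of \<open>A ^ 2 ^ Suc j\<close>, which is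
  a sum of \<open>n\<close> powers of eigenvalues, confines its growth to that of the powers of \<open>a\<close>.
\<close>

lemma entry_sum_le_spectral_radius:
  fixes A :: "real mat"
  assumes A: "A \<in> carrier_mat n n" and sym: "transpose_mat A = A"
    and cp: "char_poly A = (\<Prod>e\<leftarrow>es. [:- e, 1:])" and len: "length es = n"
    and bound: "\<And>e. e \<in> set es \<Longrightarrow> \<bar>e\<bar> \<le> a" and a: "0 < a"
  shows "(\<Sum>i<n. \<Sum>j<n. A $$ (i, j)) \<le> real n * a"
proof (rule ccontr)
  define S where "S = (\<lambda>M :: real mat. \<Sum>i<n. \<Sum>j<n. M $$ (i, j))"
  assume "\<not> ?thesis"
  then have gt: "real n * a < S A" unfolding S_def by simp
  have n: "0 < n" using gt unfolding S_def by (cases n) auto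
  define r where "r = S A / real n"
  have ra: "a < r" using gt n by (simp add: r_def field_simps)
  have Am: "A ^\<^sub>m m \<in> carrier_mat n n" for m using A by simp
  have sq: "(S (A ^\<^sub>m m))\<^sup>2 \<le> real n * S (A ^\<^sub>m (m + m))"
    "(S (A ^\<^sub>m m))\<^sup>2 \<le> (real n)\<^sup>2 * (\<Sum>i<n. (A ^\<^sub>m (m + m)) $$ (i, i))" for m
    unfolding S_def pow_mat_add[OF A]
    using entry_sum_sq_le[OF Am symmetric_pow[OF A sym], of m] by auto
  have low: "real n * r ^ (2 ^ j) \<le> S (A ^\<^sub>m (2 ^ j))" for j
  proof (induction j)
    case 0
    have "A ^\<^sub>m Suc 0 = A" using A by simp
    then show ?case using n by (simp add: r_def)
  next
    case (Suc j)
    have "(real n * r ^ (2 ^ j))\<^sup>2 \<le> (S (A ^\<^sub>m (2 ^ j)))\<^sup>2"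
      using Suc ra a by (intro power_mono) auto
    also have "\<dots> \<le> real n * S (A ^\<^sub>m (2 ^ j + 2 ^ j))" by (rule sq(1))
    finally have "real n * (real n * r ^ (2 ^ Suc j)) \<le> real n * S (A ^\<^sub>m (2 ^ Suc j))"
      by (simp add: power2_eq_square mult_2 power_add mult_ac)
    then show ?case using n by simp
  qed
  have up: "r ^ (2 ^ Suc j) \<le> real n * a ^ (2 ^ Suc j)" for j
  proof -
    have "(real n)\<^sup>2 * r ^ (2 ^ Suc j) = (real n * r ^ (2 ^ j))\<^sup>2"
      by (simp add: power2_eq_square mult_2 power_add mult_ac)
    also have "\<dots> \<le> (S (A ^\<^sub>m (2 ^ j)))\<^sup>2"
      using low[of j] ra a by (intro power_mono) auto
    also have "\<dots> \<le> (real n)\<^sup>2 * (\<Sum>i<n. (A ^\<^sub>m (2 ^ j + 2 ^ j)) $$ (i, i))" by (rule sq(2))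
    also have "(\<Sum>i<n. (A ^\<^sub>m (2 ^ j + 2 ^ j)) $$ (i, i)) = (\<Sum>e\<leftarrow>es. e ^ (2 ^ Suc j))"
      using trace_pow_eq_power_sum[OF A cp] by (simp add: mult_2)
    also have "\<dots> \<le> (\<Sum>e\<leftarrow>es. a ^ (2 ^ Suc j))"
    proof (rule sum_list_mono)
      fix e assume "e \<in> set es"
      then have "\<bar>e\<bar> ^ (2 ^ Suc j) \<le> a ^ (2 ^ Suc j)" using bound by (intro power_mono) auto
      then show "e ^ (2 ^ Suc j) \<le> a ^ (2 ^ Suc j)"
        by (metis abs_ge_self order_trans power_abs)
    qed
    also have "\<dots> = real n * a ^ (2 ^ Suc j)" by (simp add: sum_list_triv len)
    finally show ?thesis using n by simp
  qed
  obtain N where N: "real n < (r / a) ^ N"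
    using real_arch_pow[of "r / a" "real n"] ra a by (auto simp: field_simps)
  have "(r / a) ^ N \<le> (r / a) ^ (2 ^ Suc N)"
    using ra a less_exp[of "Suc N"] by (intro power_increasing) (auto simp: field_simps)
  also have "\<dots> \<le> real n"
    using up[of N] a by (simp add: power_divide divide_le_eq)
  finally show False using N by simp
qed

lemma sorted_eigenvalues:
  assumes cp: "char_poly A = (\<Prod>e\<leftarrow>es. [:- e, 1:])" and n: "length es = n" "1 \<le> n"
  shows "mat_eigenvalue A 1 = Max (set es)" and "mat_eigenvalue A n = Min (set es)"
proof -
  have "proots (char_poly A) = mset es"
    unfolding cp
  proof (induction es)
    case (Cons e es)
    have "(\<Prod>e\<leftarrow>es. [:- e, 1:]) \<noteq> 0" by (auto simp: prod_list_zero_iff)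
    then have "proots ([:- e, 1:] * (\<Prod>e\<leftarrow>es. [:- e, 1:])) = add_mset e (mset es)"
      using Cons.IH proots_mult[of "[:- e, 1:]" "\<Prod>e\<leftarrow>es. [:- e, 1:]"] by simp
    then show ?case by (simp only: list.map prod_list.Cons mset.simps)
  qed simp
  then have eig: "mat_eigenvalue A k = rev (sort es) ! (k - 1)" for k
    by (simp add: mat_eigenvalue_def)
  have nth: "sort es ! i \<in> set es" if "i < n" for i
    using nth_mem[of i "sort es"] n that by simp
  have top: "e \<le> sort es ! (n - 1)" and bot: "sort es ! 0 \<le> e" if e: "e \<in> set es" for e
  proof -
    obtain i where "i < n" "e = sort es ! i"
      using e n by (metis in_set_conv_nth length_sort set_sort)
    then show "e \<le> sort es ! (n - 1)" "sort es ! 0 \<le> e"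
      using n by (auto intro!: sorted_nth_mono)
  qed
  show "mat_eigenvalue A 1 = Max (set es)"
    unfolding eig using n top nth by (intro Max_eqI[symmetric]) (auto simp: rev_nth)
  show "mat_eigenvalue A n = Min (set es)"
    unfolding eig using n bot nth by (intro Min_eqI[symmetric]) (auto simp: rev_nth)
qed

section \<open>Squares and cubes of numbers in the unit interval\<close>

text \<open>
  The threshold \<open>4 / 5\<close> is a value where both branches work: \<open>v\<^sup>2 - v ^ 3 \<ge> v ^ 3 / 4\<close> holds exactly up
  to \<open>4 / 5\<close>, and \<open>v\<^sup>2 - v ^ 3 \<ge> (1 - v ^ 3) / 4\<close> reduces to \<open>3 * v\<^sup>2 \<ge> v + 1\<close>, true for \<open>v \<ge> 0.77\<close>.
\<close>

lemma square_gap: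
  fixes v :: real
  assumes "0 \<le> v" "v \<le> 1"
  defines "r \<equiv> if v \<le> 4 / 5 then 0 else 1 :: nat"
  shows "v ^ 3 + \<bar>v ^ 3 - real r\<bar> / 4 \<le> v\<^sup>2"
proof (cases "v \<le> 4 / 5")
  case True
  have "0 \<le> v\<^sup>2 * (1 - 5 / 4 * v)" using True by simp
  then show ?thesis using True assms by (simp add: power2_eq_square power3_eq_cube algebra_simps)
next
  case False
  have "0 \<le> (1 - v) * (3 * v\<^sup>2 - v - 1)"
  proof -
    have "v * v \<ge> 4 / 5 * v" using False by (intro mult_right_mono) auto
    then have "0 \<le> 3 * v\<^sup>2 - v - 1" using False unfolding power2_eq_square by linarith
    then show ?thesis using assms by simp
  qed
  also have "\<dots> = 4 * v\<^sup>2 - 3 * v ^ 3 - 1"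
    by (simp add: algebra_simps power2_eq_square power3_eq_cube)
  finally have "0 \<le> 4 * v\<^sup>2 - 3 * v ^ 3 - 1" .
  moreover have "v ^ 3 \<le> 1" using assms by (simp add: power_le_one)
  ultimately show ?thesis using False by (simp add: r_def field_simps)
qed

text \<open>
  Equality of the sum of cubes and the sum of squares forces every entry to be \<open>0\<close> or \<open>1\<close>, hence an
  integral sum of cubes. This is the quantitative form: the excess of the squares is at least a
  quarter of the distance from the sum of cubes to an integer, by the triangle inequality.
\<close>

lemma sum_squares_gap:
  fixes vs :: "real list"
  assumes "\<And>v. v \<in> set vs \<Longrightarrow> 0 \<le> v \<and> v \<le> 1"
  obtains k :: nat
  where "(\<Sum>v\<leftarrow>vs. v ^ 3) + \<bar>(\<Sum>v\<leftarrow>vs. v ^ 3) - real k\<bar> / 4 \<le> (\<Sum>v\<leftarrow>vs. v\<^sup>2)"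
proof -
  have "\<exists>k :: nat. (\<Sum>v\<leftarrow>vs. v ^ 3) + \<bar>(\<Sum>v\<leftarrow>vs. v ^ 3) - real k\<bar> / 4 \<le> (\<Sum>v\<leftarrow>vs. v\<^sup>2)"
    using assms
  proof (induction vs)
    case Nil
    show ?case by (intro exI[of _ 0]) simp
  next
    case (Cons v vs)
    then obtain k :: nat
      where k: "(\<Sum>v\<leftarrow>vs. v ^ 3) + \<bar>(\<Sum>v\<leftarrow>vs. v ^ 3) - real k\<bar> / 4 \<le> (\<Sum>v\<leftarrow>vs. v\<^sup>2)"
      by auto
    obtain r :: nat where r: "v ^ 3 + \<bar>v ^ 3 - real r\<bar> / 4 \<le> v\<^sup>2"
      using square_gap[of v] Cons.prems by auto
    define S where "S = (\<Sum>v\<leftarrow>vs. v ^ 3)"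
    have "\<bar>v ^ 3 + S - real (k + r)\<bar> \<le> \<bar>v ^ 3 - real r\<bar> + \<bar>S - real k\<bar>" by simp
    with k r show ?case
      unfolding S_def[symmetric] by (intro exI[of _ "k + r"]) (simp add: S_def[symmetric] field_simps)
  qed
  with that show thesis by blast
qed

text \<open>
  The claim is that \<open>x * (x - 1) / (x\<^sup>2 + q)\<close> is at most its value for \<open>x = c\<close> and \<open>q = 14\<close>. Outside
  the interval from \<open>c\<close> to \<open>2.42\<close> the estimate \<open>q \<ge> x ^ 3\<close> suffices, since
  \<open>(x - 1) / (x * (x + 1))\<close> increases up to its maximum at \<open>1 + sqrt 2\<close> and decreases afterwards.
  Inside this short interval \<open>x ^ 3\<close> is slightly more than \<open>14\<close>, and the integrality gap improves
  the estimate to \<open>q \<ge> 14 + 5 / 4 * (x ^ 3 - 14)\<close>.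
\<close>

lemma ratio_bound:
  fixes c x s q :: real and k :: nat
  assumes c: "c ^ 3 = 14" "0 < c" and x: "1 < x" and s: "x ^ 3 \<le> s"
    and q: "s + \<bar>s - real k\<bar> / 4 \<le> q"
  shows "x * (x - 1) * (c * (c + 1)) \<le> (c - 1) * (x\<^sup>2 + q)"
proof -
  have c_low: "241 / 100 \<le> c"
  proof (rule power_le_imp_le_base)
    show "(241 / 100) ^ Suc 2 \<le> c ^ Suc 2" using c by (simp add: power_divide)
  qed (use c in simp)
  have c_up: "c \<le> 24102 / 10000"
  proof (rule power_le_imp_le_base)
    show "c ^ Suc 2 \<le> (24102 / 10000) ^ Suc 2" using c by (simp add: power_divide)
  qed simp
  show ?thesis
  proof (cases "x \<le> c \<or> 242 / 100 \<le> x")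
    case True
    have x3_q: "x ^ 3 \<le> q" using s q abs_ge_zero[of "s - real k"] by (simp add: field_simps)
    \<comment> \<open>The two factors vanish at \<open>c\<close> and at \<open>(c + 1) / (c - 1)\<close>, which is about \<open>2.4183\<close>.\<close>
    have "0 \<le> (x - c) * ((c - 1) * x - (c + 1))"
    proof (cases "x \<le> c")
      case True
      have "c * c \<le> c * (24102 / 10000)" using c_low c_up by (intro mult_left_mono) auto
      then have "(c - 1) * c \<le> c + 1" using c_up by (simp add: algebra_simps)
      moreover have "(c - 1) * x \<le> (c - 1) * c" using True c_low by (intro mult_left_mono) auto
      ultimately show ?thesis using True by (intro mult_nonpos_nonpos) auto
    next
      case False
      then have "242 / 100 \<le> x" using True by simp
      then have "(c - 1) * (242 / 100) \<le> (c - 1) * x" using c_low by (intro mult_left_mono) auto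
      moreover have "c + 1 \<le> (c - 1) * (242 / 100)" using c_low by simp
      ultimately show ?thesis using False by (intro mult_nonneg_nonneg) auto
    qed
    then have "0 \<le> x * ((x - c) * ((c - 1) * x - (c + 1)))" using x by (intro mult_nonneg_nonneg[of x]) auto
    then have "x * (x - 1) * (c * (c + 1)) \<le> (c - 1) * (x\<^sup>2 + x ^ 3)"
      by (simp add: algebra_simps power2_eq_square power3_eq_cube)
    also have "\<dots> \<le> (c - 1) * (x\<^sup>2 + q)"
      using x3_q c_low by (intro mult_left_mono) auto
    finally show ?thesis .
  next
    case False
    then have xc: "c < x" and x_up: "x < 242 / 100" by auto
    have "x ^ 3 \<le> (242 / 100) ^ 3" using x x_up by (intro power_mono) auto
    then have x3_up: "x ^ 3 \<le> 14 + 1 / 2" by (simp add: power_divide)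
    \<comment> \<open>As \<open>x ^ 3\<close> lies between \<open>14\<close> and \<open>14.5\<close>, the nearest integer is \<open>14\<close>. A larger sum \<open>s\<close>
      close to another integer is no cheaper, because the distance term has slope only \<open>1 / 4\<close>.\<close>
    have "14 + 5 / 4 * (x ^ 3 - 14) \<le> q"
    proof (cases "k \<le> 14")
      case True
      then have "real k \<le> 14" by simp
      moreover have "s - real k \<le> \<bar>s - real k\<bar>" by simp
      ultimately have "5 * s - 14 \<le> 4 * q" using q by argo
      then show ?thesis using s by argo
    next
      case False
      then have "15 \<le> real k" by simp
      moreover have "real k - s \<le> \<bar>s - real k\<bar>" by simp
      ultimately have "3 * s + 15 \<le> 4 * q" using q by argo
      then show ?thesis using s x3_up by argo
    qed
    then have "(c - 1) * (x\<^sup>2 + c ^ 3 + 5 / 4 * (x ^ 3 - c ^ 3)) \<le> (c - 1) * (x\<^sup>2 + q)"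
      using c_low c by (intro mult_left_mono) auto
    moreover have "x * (x - 1) * (c * (c + 1)) \<le> (c - 1) * (x\<^sup>2 + c ^ 3 + 5 / 4 * (x ^ 3 - c ^ 3))"
    proof -
      \<comment> \<open>Both sides agree at \<open>x = c\<close>, so the factor \<open>x - c\<close> is split off their difference.\<close>
      define P where "P = x\<^sup>2 + x * c + c\<^sup>2"
      have low: "3 * (241 / 100)\<^sup>2 \<le> P"
      proof -
        have "241 / 100 * (241 / 100) \<le> y * z" if "c \<le> y" "c \<le> z" for y z
          using that c_low by (intro mult_mono) auto
        from this[of x x] this[of x c] this[of c c]
        have "3 * (241 / 100 * (241 / 100)) \<le> x * x + x * c + c * c" using xc by argo
        then show ?thesis by (simp add: P_def power2_eq_square)
      qed
      have "(c * (c + 1) - (c - 1)) * (x + c) - c * (c + 1) \<le> 5 / 4 * (c - 1) * P"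
      proof -
        have "c * c \<le> 24102 / 10000 * (24102 / 10000)"
          using c_low c_up by (intro mult_mono) auto
        moreover have "241 / 100 * (241 / 100) \<le> c * c"
          using c_low by (intro mult_mono) auto
        ultimately have cc: "c * c \<le> 581 / 100" "58 / 10 \<le> c * c" by auto
        have "(c * c + 1) * (x + c) \<le> 681 / 100 * (484 / 100)"
          using cc c_low c_up xc x_up by (intro mult_mono) auto
        moreover have "141 / 100 * (3 * (241 / 100)\<^sup>2) \<le> (c - 1) * P"
          using c_low low by (intro mult_mono) auto
        ultimately show ?thesis using cc c_low by (simp add: algebra_simps power2_eq_square)
      qed
      then have "(x - c) * ((c * (c + 1) - (c - 1)) * (x + c) - c * (c + 1))
          \<le> (x - c) * (5 / 4 * (c - 1) * P)"
        using xc by (intro mult_left_mono) auto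
      also have "(x - c) * (5 / 4 * (c - 1) * P) = (c - 1) * (5 / 4 * (x ^ 3 - c ^ 3))"
        by (simp add: P_def field_simps power2_eq_square power3_eq_cube)
      also have "(x - c) * ((c * (c + 1) - (c - 1)) * (x + c) - c * (c + 1))
          = x * (x - 1) * (c * (c + 1)) - (c - 1) * (x\<^sup>2 + c ^ 3)"
        by (simp add: algebra_simps power2_eq_square power3_eq_cube)
      finally show ?thesis by (simp add: distrib_left)
    qed
    ultimately show ?thesis by linarith
  qed
qed

text \<open>
  The negative parts of the eigenvalues other than \<open>a\<close>, divided by \<open>b\<close>, lie between \<open>0\<close> and \<open>1\<close>. As
  all cubes of eigenvalues sum to \<open>0\<close>, the cubes of these numbers sum to at least \<open>x ^ 3\<close> for
  \<open>x = a / b\<close>, while their squares sum to at most \<open>m / b * x - x\<^sup>2\<close>. The gap between squares and cubes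
  turns this into a lower bound on \<open>m / b\<close>.
\<close>

lemma eigenvalue_moment_bound:
  fixes a b c :: real and es :: "real list"
  assumes c: "c ^ 3 = 14" "0 < c"
    and a: "a \<in> set es" and range: "\<And>e. e \<in> set es \<Longrightarrow> - b \<le> e \<and> e \<le> a"
    and cubes: "(\<Sum>e\<leftarrow>es. e ^ 3) = 0"
    and squares: "b < a \<Longrightarrow> (\<Sum>e\<leftarrow>es. e\<^sup>2) \<le> m * a"
    and m: "0 < m"
  shows "(a - b) / m \<le> (1 - 1 / c) / (1 + c)"
proof -
  have c1: "1 < c"
  proof (rule ccontr)
    assume "\<not> 1 < c"
    then show False using power_le_one[of c 3] c by simp
  qed
  show ?thesis
  proof (cases "b < a")
    case False
    then have "(a - b) / m \<le> 0" using m by (simp add: divide_nonpos_pos)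
    also have "0 \<le> (1 - 1 / c) / (1 + c)" using c1 by simp
    finally show ?thesis .
  next
    case ba: True
    have a_pos: "0 < a" using range[OF a] ba by linarith
    \<comment> \<open>One copy of the largest eigenvalue is set aside; further copies remain in \<open>xs\<close>.\<close>
    define xs where "xs = remove1 a es"
    have xs: "set xs \<subseteq> set es" unfolding xs_def by (rule set_remove1_subset)
    have split: "(\<Sum>e\<leftarrow>es. f e) = f a + (\<Sum>e\<leftarrow>xs. f e)" for f :: "real \<Rightarrow> real"
      unfolding xs_def by (rule sum_list_map_remove1[OF a])
    have cubes': "(\<Sum>e\<leftarrow>xs. e ^ 3) = - (a ^ 3)" using cubes split[of "\<lambda>e. e ^ 3"] by simp
    \<comment> \<open>Without a negative eigenvalue nothing could cancel the cube of \<open>a\<close>.\<close>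
    have b_pos: "0 < b"
    proof (rule ccontr)
      assume "\<not> 0 < b"
      then have "0 \<le> e ^ 3" if "e \<in> set xs" for e using range[of e] xs that by auto
      then have "0 \<le> (\<Sum>e\<leftarrow>xs. e ^ 3)" by (intro sum_list_nonneg) auto
      with cubes' a_pos show False by (simp add: not_le[symmetric])
    qed
    define x where "x = a / b"
    define vs where "vs = map (\<lambda>e. max 0 (- e / b)) xs"
    have x1: "1 < x" using ba b_pos by (simp add: x_def)
    have "0 \<le> v \<and> v \<le> 1" if v: "v \<in> set vs" for v
    proof -
      obtain e where "e \<in> set xs" "v = max 0 (- e / b)" using v unfolding vs_def set_map by blast
      moreover from this have "- e / b \<le> 1" using range[of e] xs b_pos by (auto simp: field_simps)
      ultimately show ?thesis by simp
    qed
    then obtain k :: nat where k: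
      "(\<Sum>v\<leftarrow>vs. v ^ 3) + \<bar>(\<Sum>v\<leftarrow>vs. v ^ 3) - real k\<bar> / 4 \<le> (\<Sum>v\<leftarrow>vs. v\<^sup>2)"
      using sum_squares_gap by blast
    have "x ^ 3 = (\<Sum>e\<leftarrow>xs. (- 1 / b ^ 3) * e ^ 3)"
      unfolding sum_list_const_mult cubes' by (simp add: x_def power_divide)
    also have "\<dots> \<le> (\<Sum>e\<leftarrow>xs. max 0 (- e / b) ^ 3)"
    proof (rule sum_list_mono)
      fix e
      have "(- e / b) ^ 3 \<le> max 0 (- e / b) ^ 3" by (rule power_mono_odd) auto
      then show "(- 1 / b ^ 3) * e ^ 3 \<le> max 0 (- e / b) ^ 3" by (simp add: power_divide)
    qed
    finally have s: "x ^ 3 \<le> (\<Sum>v\<leftarrow>vs. v ^ 3)" by (simp add: vs_def o_def)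
    have "(\<Sum>v\<leftarrow>vs. v\<^sup>2) \<le> (\<Sum>e\<leftarrow>xs. (1 / b\<^sup>2) * e\<^sup>2)"
      unfolding vs_def by (auto simp: o_def max_def power_divide intro!: sum_list_mono)
    also have "\<dots> = (\<Sum>e\<leftarrow>xs. e\<^sup>2) / b\<^sup>2" unfolding sum_list_const_mult by simp
    also have "\<dots> \<le> (m * a - a\<^sup>2) / b\<^sup>2"
      using squares[OF ba] split[of "\<lambda>e. e\<^sup>2"] by (intro divide_right_mono) auto
    also have "\<dots> = m / b * x - x\<^sup>2"
      using b_pos by (simp add: x_def power2_eq_square field_simps)
    finally have q: "x\<^sup>2 + (\<Sum>v\<leftarrow>vs. v\<^sup>2) \<le> m / b * x" by simp
    have "x * (x - 1) * (c * (c + 1)) \<le> (c - 1) * (x\<^sup>2 + (\<Sum>v\<leftarrow>vs. v\<^sup>2))"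
      by (rule ratio_bound[OF c x1 s k])
    also have "\<dots> \<le> (c - 1) * (m / b * x)" using q c1 by (intro mult_left_mono) auto
    finally have "x * ((x - 1) * (c * (c + 1))) \<le> x * ((c - 1) * (m / b))" by (simp add: mult_ac)
    then have "(x - 1) * (c * (c + 1)) \<le> (c - 1) * (m / b)"
      by (rule mult_left_le_imp_le) (use x1 in simp)
    then have "b * ((x - 1) * (c * (c + 1))) \<le> b * ((c - 1) * (m / b))"
      by (rule mult_left_mono) (use b_pos in simp)
    moreover have "b * ((x - 1) * (c * (c + 1))) = (a - b) * (c * (c + 1))"
      using b_pos by (simp add: x_def field_simps)
    moreover have "b * ((c - 1) * (m / b)) = (c - 1) * m" using b_pos by simp
    ultimately have "(a - b) * (c * (c + 1)) \<le> (c - 1) * m" by simp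
    moreover have "0 < c * (c + 1)" using c1 by simp
    ultimately have "(a - b) / m \<le> (c - 1) / (c * (c + 1))"
      using m by (simp only: pos_divide_le_eq times_divide_eq_left pos_le_divide_eq)
    also have "\<dots> = (1 - 1 / c) / (1 + c)" using c1 by (simp add: field_simps)
    finally show ?thesis .
  qed
qed

section \<open>Triangle-free graphs\<close>

theorem corollary3p5:
  fixes G :: "'a pair_pre_digraph" and vs :: "'a list" and n :: nat
  assumes "pair_graph G"
    and "n = card (pverts G)" and "n \<ge> 1"
    and "distinct vs" and "set vs = pverts G"
    and "triangle_free G"
  shows "(mat_eigenvalue (adj_matrix G vs) 1 + mat_eigenvalue (adj_matrix G vs) n) / real n
           \<le> (1 - 14 powr (- (1 / 3))) / (1 + 14 powr (1 / 3))"
proof -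
  define A where "A = adj_matrix G vs"
  have len: "length vs = n" using assms by (metis distinct_card)
  have A: "A \<in> carrier_mat n n" by (simp add: A_def adj_matrix_def len)
  have entry: "A $$ (i, j) = (if (vs ! i, vs ! j) \<in> parcs G then 1 else 0)"
    if "i < n" "j < n" for i j
    using that by (simp add: A_def adj_matrix_def len)
  have symG: "(v, u) \<in> parcs G" if "(u, v) \<in> parcs G" for u v
  proof -
    interpret pair_graph G by fact
    show ?thesis using pair_sym_arcs that by (auto simp: symmetric_def sym_def)
  qed
  have sym: "transpose_mat A = A"
    using A entry symG by (intro eq_matI) auto
  obtain es where cp: "char_poly A = (\<Prod>e\<leftarrow>es. [:- e, 1:])" and es: "length es = n"
    using symmetric_char_poly_splits[OF A sym] by blast
  \<comment> \<open>The closed walks of length two at a vertex are counted by its degree.\<close>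
  have square: "(A ^\<^sub>m 2) $$ (i, i) = (\<Sum>j<n. A $$ (i, j))" if "i < n" for i
  proof -
    have "(A ^\<^sub>m 2) $$ (i, i) = (\<Sum>j<n. A $$ (i, j) * A $$ (j, i))"
      using that A by (simp add: numeral_2_eq_2 scalar_prod_def lessThan_atLeast0)
    also have "\<dots> = (\<Sum>j<n. A $$ (i, j))"
      using that symG by (intro sum.cong refl) (auto simp: entry)
    finally show ?thesis .
  qed
  \<comment> \<open>A closed walk of length three traverses a triangle.\<close>
  have cube: "(A ^\<^sub>m 3) $$ (i, i) = 0" if i: "i < n" for i
  proof -
    have "(A ^\<^sub>m 3) $$ (i, i) = (\<Sum>j<n. A $$ (i, j) * (\<Sum>k<n. A $$ (j, k) * A $$ (k, i)))"
      using that A by (simp add: numeral_3_eq_3 scalar_prod_def lessThan_atLeast0)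
    also have "\<dots> = 0"
    proof (rule sum.neutral, rule ballI)
      fix j assume j: "j \<in> {..<n}"
      have "A $$ (i, j) * (A $$ (j, k) * A $$ (k, i)) = 0" if "k < n" for k
      proof -
        have "\<not> ((vs ! i, vs ! j) \<in> parcs G \<and> (vs ! j, vs ! k) \<in> parcs G \<and> (vs ! k, vs ! i) \<in> parcs G)"
          using \<open>triangle_free G\<close> unfolding triangle_free_def by blast
        then show ?thesis using i j that by (auto simp: entry)
      qed
      then show "A $$ (i, j) * (\<Sum>k<n. A $$ (j, k) * A $$ (k, i)) = 0"
        unfolding sum_distrib_left by (intro sum.neutral) simp
    qed
    finally show ?thesis .
  qed
  define a where "a = Max (set es)"
  define b where "b = - Min (set es)"
  have ne: "set es \<noteq> {}" using es assms(3) by auto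
  have range: "- b \<le> e \<and> e \<le> a" if "e \<in> set es" for e
    using that by (simp add: a_def b_def)
  have a: "a \<in> set es" unfolding a_def using ne by simp
  have cubes: "(\<Sum>e\<leftarrow>es. e ^ 3) = 0"
    using trace_pow_eq_power_sum[OF A cp, of 3] cube by simp
  \<comment> \<open>Only when \<open>b < a\<close> is \<open>a\<close> known to bound all eigenvalues in absolute value.\<close>
  have squares: "(\<Sum>e\<leftarrow>es. e\<^sup>2) \<le> real n * a" if "b < a"
  proof -
    have "(\<Sum>e\<leftarrow>es. e\<^sup>2) = (\<Sum>i<n. \<Sum>j<n. A $$ (i, j))"
      using trace_pow_eq_power_sum[OF A cp, of 2] square by simp
    also have "\<dots> \<le> real n * a"
    proof (rule entry_sum_le_spectral_radius[OF A sym cp es])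
      show "\<bar>e\<bar> \<le> a" if "e \<in> set es" for e using range[OF that] \<open>b < a\<close> by linarith
      show "0 < a" using range[OF a] \<open>b < a\<close> by linarith
    qed
    finally show ?thesis .
  qed
  define c :: real where "c = 14 powr (1 / 3)"
  have c: "c ^ 3 = 14" "0 < c"
    unfolding c_def by (simp_all add: powr_power)
  have inv: "14 powr (- (1 / 3)) = 1 / c" unfolding c_def by (simp add: powr_minus_divide)
  have "(a - b) / real n \<le> (1 - 1 / c) / (1 + c)"
    using assms(3) by (intro eigenvalue_moment_bound[OF c a range cubes squares]) auto
  then show ?thesis
    unfolding A_def[symmetric] sorted_eigenvalues[OF cp es assms(3)] inv c_def[symmetric]
    by (simp add: a_def b_def)
qed

end
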